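(* Let $\mathcal{B}$ be a unital $C^*$-algebra with a nonzero trace $\phi$, let $n \geq 1$, let $A = (A_0, A_1, \dots, A_n)$ be an $(n+1)$-tuple of elements of $\mathcal{B}$, and let $U$ be a connected component of $P^c(A)$. Then $\phi(\omega_A(z))|_U$ is a nontrivial element of the de Rham cohomology space $H^1_d(U, \mathbb{C})$; that is, it is a closed $1$-form on $U$ whose class in $H^1_d(U, \mathbb{C})$ is nonzero. In particular, $U$ is not simply connected.
   Context: For $z = (z_0, \dots, z_n) \in \mathbb{C}^{n+1}$ put $A(z) = z_0A_0 + z_1A_1 + \cdots + z_nA_n \in \mathcal{B}$, $P(A) = \{z \in \mathbb{C}^{n+1} : A(z) \text{ is not invertible in } \mathcal{B}\}$, and $P^c(A) = \mathbb{C}^{n+1} \setminus P(A)$, an open subset of $\mathbb{C}^{n+1}$. On $P^c(A)$ define the $\mathcal{B}$-valued $1$-form $\omega_A(z) = A^{-1}(z)\,dA(z) = \sum_{j=0}^n A(z)^{-1}A_j\,dz_j$; for $\phi \in \mathcal{B}^*$, $\phi(\omega_A(z)) = \sum_{j=0}^n \phi(A(z)^{-1}A_j)\,dz_j$, a holomorphic $1$-form on $P^c(A)$. A trace on a $C^*$-algebra is a positive linear functional $\phi$ that is central, i.e. $\phi(XY) = \phi(YX)$ for all $X, Y \in \mathcal{B}$. $H^1_d(U, \mathbb{C})$ is the first de Rham cohomology of $U$ with complex coefficients. *)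

theory Defs
  imports "HOL-Analysis.Analysis"
begin

section \<open>Unital C*-algebras and traces\<close>

text \<open>
  The base class \<open>real_normed_algebra_1\<close> includes \<open>norm 1 = 1\<close>. In a unital C*-algebra this
  excludes only the zero algebra, which has no nonzero functional.
\<close>

class cstar_algebra = real_normed_algebra_1 + banach +
  fixes scaleC :: "complex \<Rightarrow> 'a \<Rightarrow> 'a"  (infixr "*\<^sub>C" 75)
    and star :: "'a \<Rightarrow> 'a"
  assumes scaleC_of_real: "scaleC (complex_of_real r) x = scaleR r x"
    and scaleC_add_right: "scaleC c (x + y) = scaleC c x + scaleC c y"
    and scaleC_add_left: "scaleC (c + d) x = scaleC c x + scaleC d x"
    and scaleC_scaleC: "scaleC c (scaleC d x) = scaleC (c * d) x"
    and mult_scaleC_left: "scaleC c x * y = scaleC c (x * y)"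
    and mult_scaleC_right: "x * scaleC c y = scaleC c (x * y)"
    and norm_scaleC: "norm (scaleC c x) = cmod c * norm x"
    and star_star: "star (star x) = x"
    and star_add: "star (x + y) = star x + star y"
    and star_scaleC: "star (scaleC c x) = scaleC (cnj c) (star x)"
    and star_mult: "star (x * y) = star y * star x"
    and norm_star_mult: "norm (star x * x) = (norm x)\<^sup>2"

instantiation complex :: cstar_algebra
begin

definition scaleC_complex :: "complex \<Rightarrow> complex \<Rightarrow> complex"
  where "scaleC_complex c x = c * x"

definition star_complex :: "complex \<Rightarrow> complex"
  where "star_complex x = cnj x"

instance
  by standard
    (auto simp: scaleC_complex_def star_complex_def algebra_simps scaleR_conv_of_real
      norm_mult power2_eq_square)

end

definition is_inverse :: "'b::cstar_algebra \<Rightarrow> 'b \<Rightarrow> bool"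
  where "is_inverse x y \<longleftrightarrow> x * y = 1 \<and> y * x = 1"

definition invertible_elt :: "'b::cstar_algebra \<Rightarrow> bool"
  where "invertible_elt x \<longleftrightarrow> (\<exists>y. is_inverse x y)"

definition alg_inverse :: "'b::cstar_algebra \<Rightarrow> 'b"
  where "alg_inverse x = (THE y. is_inverse x y)"

definition clinear_functional :: "('b::cstar_algebra \<Rightarrow> complex) \<Rightarrow> bool"
  where "clinear_functional \<phi> \<longleftrightarrow>
    (\<forall>x y. \<phi> (x + y) = \<phi> x + \<phi> y) \<and> (\<forall>c x. \<phi> (c *\<^sub>C x) = c * \<phi> x)"

definition positive_functional :: "('b::cstar_algebra \<Rightarrow> complex) \<Rightarrow> bool"
  where "positive_functional \<phi> \<longleftrightarrow>
    clinear_functional \<phi> \<and> (\<forall>x. \<phi> (star x * x) \<in> \<real>\<^sub>\<ge>\<^sub>0)"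

definition is_trace :: "('b::cstar_algebra \<Rightarrow> complex) \<Rightarrow> bool"
  where "is_trace \<phi> \<longleftrightarrow> positive_functional \<phi> \<and> (\<forall>x y. \<phi> (x * y) = \<phi> (y * x))"

section \<open>The projective joint spectrum and the form \<open>\<omega>\<^sub>A\<close>\<close>

text \<open>\<open>\<complex>\<^sup>n\<^sup>+\<^sup>1\<close> is \<open>complex ^ 'n\<close> for an index type with \<open>n + 1\<close> elements.\<close>

definition pencil :: "('n::finite \<Rightarrow> 'b::cstar_algebra) \<Rightarrow> complex ^ 'n \<Rightarrow> 'b"
  where "pencil A z = (\<Sum>j\<in>UNIV. (z $ j) *\<^sub>C A j)"

definition proj_spectrum :: "('n::finite \<Rightarrow> 'b::cstar_algebra) \<Rightarrow> (complex ^ 'n) set"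
  where "proj_spectrum A = {z. \<not> invertible_elt (pencil A z)}"

definition proj_resolvent :: "('n::finite \<Rightarrow> 'b::cstar_algebra) \<Rightarrow> (complex ^ 'n) set"
  where "proj_resolvent A = - proj_spectrum A"

text \<open>
  A 1-form with values in a real vector space is a map taking a point \<open>z\<close> and a tangent vector
  \<open>v\<close> to a value that is linear in \<open>v\<close>; in particular \<open>dz\<^sub>j\<close> is \<open>\<lambda>z v. v $ j\<close>.
\<close>

definition omega_form ::
    "('n::finite \<Rightarrow> 'b::cstar_algebra) \<Rightarrow> complex ^ 'n \<Rightarrow> complex ^ 'n \<Rightarrow> 'b"
  where "omega_form A z v = (\<Sum>j\<in>UNIV. (v $ j) *\<^sub>C (alg_inverse (pencil A z) * A j))"

definition trace_form ::
    "('b::cstar_algebra \<Rightarrow> complex) \<Rightarrow> ('n::finite \<Rightarrow> 'b) \<Rightarrow> complex ^ 'n \<Rightarrow> complex ^ 'n \<Rightarrow> complex"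
  where "trace_form \<phi> A z v = \<phi> (omega_form A z v)"

section \<open>First de Rham cohomology with complex coefficients\<close>

text \<open>
  Throughout, \<open>U\<close> is an open subset of a Euclidean space. Functions and forms are total, and
  every notion below depends only on their values on \<open>U\<close>. Complex-valued forms are real-linear
  in the tangent vector, and smoothness is over the reals.
\<close>

primrec Ck_on :: "nat \<Rightarrow> 'a::euclidean_space set \<Rightarrow> ('a \<Rightarrow> complex) \<Rightarrow> bool"
  where
    "Ck_on 0 U f \<longleftrightarrow> continuous_on U f"
  | "Ck_on (Suc k) U f \<longleftrightarrow>
      (\<forall>x\<in>U. f differentiable (at x)) \<and>
      (\<forall>v. Ck_on k U (\<lambda>x. frechet_derivative f (at x) v))"

definition smooth_on :: "'a::euclidean_space set \<Rightarrow> ('a \<Rightarrow> complex) \<Rightarrow> bool"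
  where "smooth_on U f \<longleftrightarrow> (\<forall>k. Ck_on k U f)"

definition one_forms :: "'a::euclidean_space set \<Rightarrow> ('a \<Rightarrow> 'a \<Rightarrow> complex) set"
  where "one_forms U = {\<omega>. (\<forall>z\<in>U. linear (\<omega> z)) \<and> (\<forall>v. smooth_on U (\<lambda>z. \<omega> z v))}"

definition d0 :: "('a::euclidean_space \<Rightarrow> complex) \<Rightarrow> 'a \<Rightarrow> 'a \<Rightarrow> complex"
  where "d0 f z v = frechet_derivative f (at z) v"

text \<open>The usual formula for \<open>d\<omega>(u, v)\<close> on constant vector fields, whose bracket vanishes.\<close>

definition d1 :: "('a::euclidean_space \<Rightarrow> 'a \<Rightarrow> complex) \<Rightarrow> 'a \<Rightarrow> 'a \<Rightarrow> 'a \<Rightarrow> complex"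
  where "d1 \<omega> z u v =
    frechet_derivative (\<lambda>x. \<omega> x v) (at z) u - frechet_derivative (\<lambda>x. \<omega> x u) (at z) v"

definition closed_forms :: "'a::euclidean_space set \<Rightarrow> ('a \<Rightarrow> 'a \<Rightarrow> complex) set"
  where "closed_forms U = {\<omega> \<in> one_forms U. \<forall>z\<in>U. \<forall>u v. d1 \<omega> z u v = 0}"

definition cohomologous ::
    "'a::euclidean_space set \<Rightarrow> (('a \<Rightarrow> 'a \<Rightarrow> complex) \<times> ('a \<Rightarrow> 'a \<Rightarrow> complex)) set"
  where "cohomologous U = {(\<omega>, \<eta>). \<omega> \<in> closed_forms U \<and> \<eta> \<in> closed_forms U \<and>
    (\<exists>f. smooth_on U f \<and> (\<forall>z\<in>U. \<forall>v. \<omega> z v - \<eta> z v = d0 f z v))}"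

definition deRham_H1 :: "'a::euclidean_space set \<Rightarrow> ('a \<Rightarrow> 'a \<Rightarrow> complex) set set"
  where "deRham_H1 U = closed_forms U // cohomologous U"

definition deRham_class ::
    "'a::euclidean_space set \<Rightarrow> ('a \<Rightarrow> 'a \<Rightarrow> complex) \<Rightarrow> ('a \<Rightarrow> 'a \<Rightarrow> complex) set"
  where "deRham_class U \<omega> = cohomologous U `` {\<omega>}"

definition deRham_zero :: "'a::euclidean_space set \<Rightarrow> ('a \<Rightarrow> 'a \<Rightarrow> complex) set"
  where "deRham_zero U = deRham_class U (\<lambda>z v. 0)"

end

theory Submission
  imports Defs
begin

text \<open>
  Since \<open>A\<close> is homogeneous, \<open>U\<close> contains with \<open>z\<close> the circle \<open>t \<mapsto> e\<^sup>i\<^sup>t z\<close>, along which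
  \<open>\<phi>(\<omega>\<^sub>A)\<close> is constantly \<open>i \<phi>(1) dt\<close>; and \<open>\<phi>(1) \<noteq> 0\<close> by the Cauchy--Schwarz inequality.
  A primitive of the form would therefore be multivalued. Centrality of \<open>\<phi>\<close> makes the form closed.

  If \<open>U\<close> were simply connected, the circle would bound a continuous disc \<open>F\<close> in \<open>U\<close>. By closedness
  the integrals of the form over short segments \<open>[F p, F q]\<close> satisfy the cocycle identity
  \<open>c p q + c q r = c p r\<close>, and such a local cocycle on a convex set is a coboundary \<open>g q - g p\<close>.
  Summing over the edges of a regular polygon inscribed in the unit circle gives
  \<open>2 \<pi> i \<phi>(1) = 0\<close>. No smoothness of the homotopy is needed.
\<close>

section \<open>Positive functionals\<close>

lemma scaleC_one [simp]: "1 *\<^sub>C x = (x::'b::cstar_algebra)"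
  using scaleC_of_real[of 1 x] by simp

lemma scaleR_scaleC_commute: "r *\<^sub>R (c *\<^sub>C x) = c *\<^sub>C (r *\<^sub>R (x::'b::cstar_algebra))"
  by (simp flip: scaleC_of_real add: scaleC_scaleC mult.commute)

lemma scaleC_sum_right: "c *\<^sub>C (\<Sum>i\<in>I. f i) = (\<Sum>i\<in>I. c *\<^sub>C (f i :: 'b::cstar_algebra))"
proof -
  have "linear (\<lambda>x::'b. c *\<^sub>C x)"
    by (rule linearI) (simp_all add: scaleC_add_right scaleR_scaleC_commute)
  then show ?thesis
    by (rule linear_sum)
qed

lemma star_one [simp]: "star 1 = (1::'b::cstar_algebra)"
  by (metis mult.left_neutral mult.right_neutral star_mult star_star)

lemma star_power: "star (x ^ n) = star (x::'b::cstar_algebra) ^ n"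
  by (induction n) (auto simp: star_mult power_commutes)

text \<open>The C*-identity and submultiplicativity of the norm give
  \<open>norm y \<le> norm (star y)\<close>; using this for \<open>x\<close> and for
  \<open>star x\<close> yields both inequalities.\<close>

lemma norm_star [simp]: "norm (star x) = norm (x::'b::cstar_algebra)"
proof -
  have le: "norm y \<le> norm (star y)" for y :: 'b
  proof (cases "y = 0")
    case False
    have "norm y * norm y \<le> norm (star y) * norm y"
      using norm_mult_ineq[of "star y" y] by (simp add: norm_star_mult power2_eq_square)
    then show ?thesis
      using False by simp
  qed simp
  show ?thesis
    using le[of x] le[of "star x"] by (simp add: star_star)
qed

lemma bounded_linear_star: "bounded_linear (star :: 'b::cstar_algebra \<Rightarrow> 'b)"
proof (rule bounded_linear_intro[of _ 1])
  show "star (r *\<^sub>R x) = r *\<^sub>R star (x::'b)" for r x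
    by (simp flip: scaleC_of_real add: star_scaleC)
qed (auto simp: star_add)

text \<open>The root is the binomial series of exponent 1/2 at \<open>h\<close>. It converges
  absolutely in the unit ball, and its real coefficients make the sum self-adjoint.\<close>

lemma selfadjoint_sqrt:
  fixes h :: "'b::cstar_algebra"
  assumes "star h = h" and "norm h < 1"
  obtains y where "star y = y" and "y * y = 1 + h"
proof -
  define c :: "nat \<Rightarrow> real" where "c n = (1/2) gchoose n" for n
  define a where "a n = c n *\<^sub>R h ^ n" for n
  have "summable (\<lambda>n. norm (c n * norm h ^ n))"
    unfolding c_def using assms(2)
    by (intro abs_summable_in_conv_radius) (simp add: conv_radius_gchoose)
  then have norm_summable: "summable (\<lambda>n. norm (a n))"
    by (rule summable_comparison_test[rotated])
       (auto simp: a_def abs_mult intro!: mult_left_mono norm_power_ineq)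
  then have a_sums: "summable a"
    by (rule summable_norm_cancel)
  have "star (suminf a) = (\<Sum>n. star (a n))"
    using bounded_linear.suminf[OF bounded_linear_star a_sums] .
  also have "(\<lambda>n. star (a n)) = a"
    by (rule ext) (simp add: a_def linear_cmul[OF bounded_linear.linear[OF bounded_linear_star]] star_power assms(1))
  finally have selfadj: "star (suminf a) = suminf a" .
  \<comment> \<open>Vandermonde with 1/2 + 1/2 = 1: the Cauchy square has the coefficients of the
    first power of \<open>1 + h\<close>, which vanish from \<open>k = 2\<close> on.\<close>
  have conv: "(\<Sum>i\<le>k. a i * a (k - i)) = of_nat (1 choose k) * h ^ k" for k
  proof -
    have "(\<Sum>i\<le>k. a i * a (k - i)) = (\<Sum>i\<le>k. (c i * c (k - i)) *\<^sub>R h ^ k)"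
      by (intro sum.cong refl) (auto simp: a_def mult_ac simp flip: power_add)
    also have "\<dots> = (\<Sum>i\<le>k. c i * c (k - i)) *\<^sub>R h ^ k"
      by (simp add: scaleR_sum_left)
    also have "(\<Sum>i\<le>k. c i * c (k - i)) = (of_nat 1 :: real) gchoose k"
      unfolding c_def using gbinomial_Vandermonde[of "1/2::real" "1/2" k]
      by (simp add: atLeast0AtMost)
    also have "\<dots> = real (1 choose k)"
      by (rule binomial_gbinomial[symmetric])
    finally show ?thesis
      by (metis scaleR_conv_of_real of_real_of_nat_eq)
  qed
  have "(\<lambda>k. of_nat (1 choose k) * h ^ k) sums (suminf a * suminf a)"
    using Cauchy_product_sums[OF norm_summable norm_summable] by (simp add: conv)
  moreover have "(\<lambda>k. of_nat (1 choose k) * h ^ k) sums (\<Sum>k\<in>{0,1}. of_nat (1 choose k) * h ^ k)"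
    by (rule sums_finite) (auto simp: binomial_eq_0)
  ultimately have "suminf a * suminf a = 1 + h"
    using sums_unique2 by fastforce
  with selfadj that show ?thesis
    by blast
qed

section \<open>Hermitian symmetry, Cauchy-Schwarz and continuity\<close>

lemma positive_functional_simps:
  assumes "positive_functional \<phi>"
  shows "\<phi> (x + y) = \<phi> x + \<phi> y" "\<phi> (c *\<^sub>C x) = c * \<phi> x" "\<phi> (star x * x) \<in> \<real>\<^sub>\<ge>\<^sub>0"
  using assms by (auto simp: positive_functional_def clinear_functional_def)

text \<open>Polarization: reality of \<open>\<phi>\<close> at the square of
  \<open>x + c *\<^sub>C 1\<close> gives the imaginary parts for \<open>c = 1\<close> and the real
  parts for \<open>c = \<i>\<close>.\<close>

lemma positive_functional_star:
  assumes "positive_functional \<phi>"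
  shows "\<phi> (star x) = cnj (\<phi> x)"
proof -
  note \<phi> = positive_functional_simps[OF assms]
  have expand: "\<phi> (star (x + c *\<^sub>C 1) * (x + c *\<^sub>C 1)) =
      \<phi> (star x * x) + c * \<phi> (star x) + cnj c * \<phi> x + cnj c * c * \<phi> 1" for c
    by (simp add: star_add star_scaleC distrib_left distrib_right mult_scaleC_left
        mult_scaleC_right \<phi> scaleC_scaleC)
  have "\<phi> (star x * x) \<in> \<real>" "\<phi> 1 \<in> \<real>"
    using \<phi>(3)[of x] \<phi>(3)[of 1] by (auto simp: complex_nonneg_Reals_iff complex_is_Real_iff)
  moreover have "\<phi> (star (x + c *\<^sub>C 1) * (x + c *\<^sub>C 1)) \<in> \<real>" for c
    using \<phi>(3) by (auto simp: complex_nonneg_Reals_iff complex_is_Real_iff)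
  note this[of 1, unfolded expand] this[of \<i>, unfolded expand]
  ultimately show ?thesis
    by (auto simp: complex_is_Real_iff complex_eq_iff)
qed

text \<open>Positivity at \<open>x + c *\<^sub>C 1\<close> with \<open>c\<close> a real multiple of
  \<open>\<phi> x\<close> gives a quadratic in \<open>s\<close> that is nowhere negative. The
  degenerate case is stated separately because it shows that a nonzero positive functional does not
  vanish at 1.\<close>

lemma positive_functional_Cauchy_Schwarz:
  assumes "positive_functional \<phi>"
  shows "(cmod (\<phi> x))\<^sup>2 \<le> Re (\<phi> (star x * x)) * Re (\<phi> 1)"
    and "Re (\<phi> 1) = 0 \<Longrightarrow> \<phi> x = 0"
proof -
  note \<phi> = positive_functional_simps[OF assms]
  define X where "X = Re (\<phi> (star x * x))"
  define m where "m = (cmod (\<phi> x))\<^sup>2"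
  have m: "m = Re (\<phi> x) * Re (\<phi> x) + Im (\<phi> x) * Im (\<phi> x)"
    unfolding m_def cmod_power2 by (simp add: power2_eq_square)
  have one: "Im (\<phi> 1) = 0" "Re (\<phi> 1) \<ge> 0" and "X \<ge> 0"
    using \<phi>(3)[of 1] \<phi>(3)[of x] by (auto simp: complex_nonneg_Reals_iff X_def)
  have quadratic: "0 \<le> X - 2 * s * m + s * s * m * Re (\<phi> 1)" for s
  proof -
    define c where "c = - complex_of_real s * \<phi> x"
    have "\<phi> (star (x + c *\<^sub>C 1) * (x + c *\<^sub>C 1)) =
      \<phi> (star x * x) + c * \<phi> (star x) + cnj c * \<phi> x + cnj c * c * \<phi> 1"
      by (simp add: star_add star_scaleC distrib_left distrib_right mult_scaleC_left
        mult_scaleC_right \<phi> scaleC_scaleC)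
    then have "0 \<le> Re (\<phi> (star x * x) + c * \<phi> (star x) + cnj c * \<phi> x + cnj c * c * \<phi> 1)"
      using \<phi>(3)[of "x + c *\<^sub>C 1"] by (simp only: complex_nonneg_Reals_iff)
    then show ?thesis
      by (simp add: positive_functional_star[OF assms] c_def X_def m one algebra_simps)
  qed
  show zero: "\<phi> x = 0" if "Re (\<phi> 1) = 0"
  proof (rule ccontr)
    assume "\<phi> x \<noteq> 0"
    then have "m > 0"
      by (simp add: m_def)
    \<comment> \<open>With \<open>Re (\<phi> 1) = 0\<close> the quadratic is affine of slope
      \<open>- 2 * m\<close>, so a large \<open>s\<close> makes it negative.\<close>
    then have "0 \<le> X - 2 * (X + 1)"
      using quadratic[of "(X + 1) / m"] that by simp
    then show False
      using \<open>X \<ge> 0\<close> by simp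
  qed
  show "(cmod (\<phi> x))\<^sup>2 \<le> Re (\<phi> (star x * x)) * Re (\<phi> 1)"
  proof (cases "Re (\<phi> 1) = 0")
    case False
    \<comment> \<open>The value of \<open>s\<close> is the minimizer of the quadratic when
      \<open>m > 0\<close>.\<close>
    then have "0 \<le> X - m / Re (\<phi> 1)"
      using quadratic[of "1 / Re (\<phi> 1)"] by simp
    then show ?thesis
      using False one unfolding m_def[symmetric] X_def[symmetric] by (simp add: pos_divide_le_eq)
  qed (simp add: zero)
qed

text \<open>
  Continuity is automatic: for \<open>norm x < 1\<close> the element \<open>1 - star x * x\<close> has a self-adjoint square
  root, hence \<open>\<phi> (star x * x) \<le> \<phi> 1\<close>.
\<close>

lemma positive_functional_bounded_linear:
  assumes "positive_functional \<phi>"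
  shows "bounded_linear \<phi>"
proof -
  note \<phi> = positive_functional_simps[OF assms]
  have scaleR: "\<phi> (r *\<^sub>R x) = r *\<^sub>R \<phi> x" for r x
    using \<phi>(2)[of "complex_of_real r" x] unfolding scaleC_of_real
    by (simp add: scaleR_conv_of_real[of r "\<phi> x"])
  have one: "Re (\<phi> 1) \<ge> 0"
    using \<phi>(3)[of 1] by (auto simp: complex_nonneg_Reals_iff)
  have unit_ball: "cmod (\<phi> x) \<le> Re (\<phi> 1)" if "norm x < 1" for x
  proof -
    have sq: "norm (star x * x) < 1"
      using that by (simp add: norm_star_mult power_less_one_iff)
    have "star (- (star x * x)) = - (star x * x)"
      using linear_neg[OF bounded_linear.linear[OF bounded_linear_star], of "star x * x"]
      by (simp add: star_mult star_star)
    then obtain y where y: "star y = y" "y * y = 1 + - (star x * x)"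
      using selfadjoint_sqrt[of "- (star x * x)"] sq by auto
    have "\<phi> 1 = \<phi> (star y * y) + \<phi> (star x * x)"
      using y by (simp flip: \<phi>(1))
    then have "Re (\<phi> (star x * x)) \<le> Re (\<phi> 1)"
      using \<phi>(3)[of y] by (simp add: complex_nonneg_Reals_iff)
    then have "Re (\<phi> (star x * x)) * Re (\<phi> 1) \<le> Re (\<phi> 1) * Re (\<phi> 1)"
      using one by (rule mult_right_mono)
    then have "(cmod (\<phi> x))\<^sup>2 \<le> (Re (\<phi> 1))\<^sup>2"
      using positive_functional_Cauchy_Schwarz(1)[OF assms, of x] by (simp add: power2_eq_square)
    then show ?thesis
      using one by (rule power2_le_imp_le)
  qed
  have "norm (\<phi> x) \<le> norm x * (2 * Re (\<phi> 1))" for x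
  proof (cases "x = 0")
    case True
    then show ?thesis
      using scaleR[of 0 0] by simp
  next
    case False
    \<comment> \<open>The bound holds on the open unit ball, so \<open>x\<close> is scaled to norm
      1/2; hence the factor 2.\<close>
    have "cmod (\<phi> ((1 / (2 * norm x)) *\<^sub>R x)) \<le> Re (\<phi> 1)"
      using False by (intro unit_ball) simp
    then show ?thesis
      using False by (simp add: scaleR field_simps)
  qed
  then show ?thesis
    by (intro bounded_linear_intro) (auto simp: \<phi> scaleR)
qed

section \<open>The inverse and the resolvent of the pencil\<close>

lemma is_inverse_unique: "is_inverse x y \<Longrightarrow> is_inverse x z \<Longrightarrow> y = (z::'b::cstar_algebra)"
  unfolding is_inverse_def by (metis mult.assoc mult.left_neutral mult.right_neutral)

lemma alg_inverse_eqI: "is_inverse x y \<Longrightarrow> alg_inverse x = (y::'b::cstar_algebra)"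
  unfolding alg_inverse_def by (rule the_equality) (auto intro: is_inverse_unique)

lemma alg_inverse_mult [simp]:
  assumes "invertible_elt (x::'b::cstar_algebra)"
  shows "x * alg_inverse x = 1" "alg_inverse x * x = 1"
  using assms alg_inverse_eqI[of x] by (auto simp: invertible_elt_def is_inverse_def)

lemma alg_inverse_mult_assoc [simp]:
  assumes "invertible_elt (x::'b::cstar_algebra)"
  shows "x * (alg_inverse x * y) = y" "alg_inverse x * (x * y) = y"
  using assms by (simp_all flip: mult.assoc)

lemma is_inverse_scaleC:
  "c \<noteq> 0 \<Longrightarrow> is_inverse x y \<Longrightarrow> is_inverse (c *\<^sub>C x) (inverse c *\<^sub>C (y::'b::cstar_algebra))"
  by (simp add: is_inverse_def mult_scaleC_left mult_scaleC_right scaleC_scaleC)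

lemma invertible_scaleC: "c \<noteq> 0 \<Longrightarrow> invertible_elt x \<Longrightarrow> invertible_elt (c *\<^sub>C (x::'b::cstar_algebra))"
  unfolding invertible_elt_def using is_inverse_scaleC by blast

lemma alg_inverse_scaleC:
  "c \<noteq> 0 \<Longrightarrow> invertible_elt x \<Longrightarrow>
    alg_inverse (c *\<^sub>C (x::'b::cstar_algebra)) = inverse c *\<^sub>C alg_inverse x"
  by (intro alg_inverse_eqI is_inverse_scaleC) (auto simp: is_inverse_def)

lemma invertible_mult:
  assumes "invertible_elt (x::'b::cstar_algebra)" "invertible_elt y"
  shows "invertible_elt (x * y)"
  unfolding invertible_elt_def is_inverse_def
  by (rule exI[of _ "alg_inverse y * alg_inverse x"]) (simp add: assms mult.assoc)

text \<open>The inverse is the Neumann series; splitting off its first term gives both one-sided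
  identities.\<close>

lemma invertible_one_minus:
  fixes h :: "'b::cstar_algebra"
  assumes "norm h < 1"
  shows "invertible_elt (1 - h)"
proof -
  have summ: "summable (\<lambda>n. h ^ n)"
    using assms by (rule complete_algebra_summable_geometric)
  have split: "(\<Sum>n. h ^ n) = (\<Sum>n. h ^ Suc n) + 1"
    using suminf_split_head[OF summ] by simp
  have "(\<Sum>n. h ^ Suc n) = h * (\<Sum>n. h ^ n)"
    using suminf_mult[OF summ, of h] by simp
  moreover have "(\<Sum>n. h ^ Suc n) = (\<Sum>n. h ^ n) * h"
    using suminf_mult2[OF summ, of h] by (simp add: power_commutes)
  ultimately have "is_inverse (1 - h) (\<Sum>n. h ^ n)"
    using split by (simp add: is_inverse_def algebra_simps)
  then show ?thesis
    by (auto simp: invertible_elt_def)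
qed

text \<open>Factor \<open>y\<close> as \<open>x\<close> times
  \<open>1 - alg_inverse x * (x - y)\<close>, where the second factor is invertible by the Neumann
  series.\<close>

lemma invertible_perturb:
  fixes x :: "'b::cstar_algebra"
  assumes x: "invertible_elt x" and d: "norm (alg_inverse x) * norm (y - x) < 1"
  shows "invertible_elt y"
proof -
  have "norm (alg_inverse x * (x - y)) < 1"
    using norm_mult_ineq[of "alg_inverse x" "x - y"] d by (simp add: norm_minus_commute)
  then have "invertible_elt (x * (1 - alg_inverse x * (x - y)))"
    by (intro invertible_mult x invertible_one_minus)
  also have "x * (1 - alg_inverse x * (x - y)) = y"
    using x by (simp add: algebra_simps)
  finally show ?thesis .
qed

lemma open_invertible: "open {x::'b::cstar_algebra. invertible_elt x}"
  unfolding open_dist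
proof (intro ballI)
  fix x :: 'b
  assume x: "x \<in> {x. invertible_elt x}"
  define e where "e = 1 / (norm (alg_inverse x) + 1)"
  have "invertible_elt y" if "dist y x < e" for y
  proof (rule invertible_perturb[of x])
    have "norm (alg_inverse x) * norm (y - x) \<le> (norm (alg_inverse x) + 1) * norm (y - x)"
      by (simp add: mult_right_mono)
    also have "\<dots> < 1"
      using that by (simp add: e_def dist_norm field_simps add_pos_nonneg)
    finally show "norm (alg_inverse x) * norm (y - x) < 1" .
  qed (use x in simp)
  moreover have "e > 0"
    by (simp add: e_def add_nonneg_pos)
  ultimately show "\<exists>e>0. \<forall>y. dist y x < e \<longrightarrow> y \<in> {x. invertible_elt x}"
    by blast
qed

lemma resolvent_identity:
  assumes "invertible_elt (x::'b::cstar_algebra)" "invertible_elt y"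
  shows "alg_inverse y = alg_inverse x - alg_inverse y * (y - x) * alg_inverse x"
proof -
  have "alg_inverse y * (y - x) * alg_inverse x = alg_inverse x - alg_inverse y"
    using assms by (simp add: algebra_simps)
  then show ?thesis
    by simp
qed

text \<open>The resolvent identity bounds the left side by \<open>norm (alg_inverse x)\<close> plus
  half of itself, and that half is absorbed.\<close>

lemma norm_alg_inverse_near:
  assumes x: "invertible_elt (x::'b::cstar_algebra)" and y: "invertible_elt y"
    and d: "norm (alg_inverse x) * norm (y - x) \<le> 1/2"
  shows "norm (alg_inverse y) \<le> 2 * norm (alg_inverse x)"
proof -
  let ?x = "alg_inverse x" and ?y = "alg_inverse y"
  have "norm ?y \<le> norm ?x + norm (?y * (y - x) * ?x)"
    by (subst resolvent_identity[OF x y]) (rule norm_triangle_ineq4)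
  also have "norm (?y * (y - x) * ?x) \<le> norm ?y * norm (y - x) * norm ?x"
    by (meson mult_right_mono norm_ge_zero norm_mult_ineq order_trans)
  also have "\<dots> = norm ?y * (norm ?x * norm (y - x))"
    by simp
  also have "\<dots> \<le> norm ?y * (1/2)"
    by (intro mult_left_mono d) simp
  finally show ?thesis
    by simp
qed

text \<open>The remainder is an exact product containing \<open>y - x\<close> twice, as iterating
  the resolvent identity shows; with \<open>alg_inverse y\<close> bounded near \<open>x\<close> it
  is of second order.\<close>

lemma has_derivative_alg_inverse:
  fixes x :: "'b::cstar_algebra"
  assumes x: "invertible_elt x"
  shows "(alg_inverse has_derivative (\<lambda>h. - (alg_inverse x * h * alg_inverse x))) (at x)"
proof -
  let ?x = "alg_inverse x"
  \<comment> \<open>Within this radius \<open>y\<close> is invertible and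
    \<open>norm_alg_inverse_near\<close> applies. The added 1 keeps the denominator
    positive.\<close>
  define e where "e = 1 / (2 * (norm ?x + 1))"
  have e: "e > 0"
    by (simp add: e_def add_nonneg_pos)
  show ?thesis
  proof (rule has_derivativeI_sandwich[OF e])
    show "bounded_linear (\<lambda>h. - (?x * h * ?x))"
      by (intro bounded_linear_minus bounded_linear_mult_left[THEN bounded_linear_compose]
          bounded_linear_mult_right)
    show "((\<lambda>y. 2 * norm ?x ^ 3 * norm (y - x)) \<longlongrightarrow> 0) (at x)"
      by (auto intro!: tendsto_eq_intros)
    fix y
    assume "y \<noteq> x" "dist y x < e"
    have "norm ?x * norm (y - x) \<le> (norm ?x + 1) * norm (y - x)"
      by (simp add: mult_right_mono)
    also have "\<dots> \<le> 1/2"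
      using \<open>dist y x < e\<close> by (simp add: e_def dist_norm field_simps add_pos_nonneg)
    finally have d: "norm ?x * norm (y - x) \<le> 1/2" .
    then have y: "invertible_elt y"
      using invertible_perturb[OF x, of y] by simp
    have "(alg_inverse y - ?x) - - (?x * (y - x) * ?x) = alg_inverse y * (y - x) * ?x * (y - x) * ?x"
      using x y by (simp add: algebra_simps mult_2)
    also have "norm \<dots> \<le> norm (alg_inverse y) * norm (y - x) * norm ?x * norm (y - x) * norm ?x"
      by (meson mult_right_mono norm_ge_zero norm_mult_ineq order_trans)
    also have "\<dots> \<le> (2 * norm ?x) * norm (y - x) * norm ?x * norm (y - x) * norm ?x"
      by (intro mult_right_mono norm_alg_inverse_near x y d norm_ge_zero)
    finally show "norm ((alg_inverse y - ?x) - - (?x * (y - x) * ?x)) / norm (y - x)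
        \<le> 2 * norm ?x ^ 3 * norm (y - x)"
      using \<open>y \<noteq> x\<close> by (simp add: field_simps power3_eq_cube)
  qed
qed

lemma continuous_on_alg_inverse [continuous_intros]:
  fixes f :: "'a::topological_space \<Rightarrow> 'b::cstar_algebra"
  assumes "continuous_on S f" "\<And>x. x \<in> S \<Longrightarrow> invertible_elt (f x)"
  shows "continuous_on S (\<lambda>x. alg_inverse (f x))"
proof (rule continuous_on_compose2[of "{x. invertible_elt x}" alg_inverse])
  show "continuous_on {x::'b. invertible_elt x} alg_inverse"
    by (rule has_derivative_continuous_on) (auto intro: has_derivative_at_withinI has_derivative_alg_inverse)
qed (use assms in auto)

lemma has_vector_derivative_alg_inverse:
  fixes f :: "real \<Rightarrow> 'b::cstar_algebra"
  assumes "(f has_vector_derivative f') (at t within S)" "invertible_elt (f t)"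
  shows "((\<lambda>t. alg_inverse (f t)) has_vector_derivative
      - (alg_inverse (f t) * f' * alg_inverse (f t))) (at t within S)"
  using has_derivative_in_compose[OF assms(1)[unfolded has_vector_derivative_def]
      has_derivative_at_withinI[OF has_derivative_alg_inverse[OF assms(2)]]]
  by (simp add: has_vector_derivative_def)

section \<open>The pencil and its resolvent set\<close>

lemma linear_pencil: "linear (pencil A)"
proof (rule linearI)
  show "pencil A (x + y) = pencil A x + pencil A y" for x y
    by (simp add: pencil_def scaleC_add_left sum.distrib)
  show "pencil A (r *\<^sub>R x) = r *\<^sub>R pencil A x" for r x
  proof -
    have "(r *\<^sub>R x $ j) *\<^sub>C A j = r *\<^sub>R (x $ j *\<^sub>C A j)" for j
      unfolding scaleR_conv_of_real[of r "x $ j"]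
      by (simp add: scaleC_of_real flip: scaleC_scaleC)
    then show ?thesis
      by (simp add: pencil_def scaleR_sum_right)
  qed
qed

lemma bounded_linear_pencil: "bounded_linear (pencil A)"
  using linear_pencil by (rule linear_conv_bounded_linear[THEN iffD1])

lemma pencil_cscale: "pencil A (c *s z) = c *\<^sub>C pencil A z"
  by (simp add: pencil_def scaleC_sum_right scaleC_scaleC)

text \<open>By linearity \<open>pencil A v\<close> is the derivative of the pencil in direction
  \<open>v\<close>, so this is the coordinate-free form of \<open>A(z)^-1 dA(z)\<close>, from which
  later computations start.\<close>

lemma trace_form_eq: "trace_form \<phi> A z v = \<phi> (alg_inverse (pencil A z) * pencil A v)"
  by (simp add: trace_form_def omega_form_def pencil_def[of A v] sum_distrib_left mult_scaleC_right)

lemma mem_proj_resolvent: "z \<in> proj_resolvent A \<longleftrightarrow> invertible_elt (pencil A z)"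
  by (simp add: proj_resolvent_def proj_spectrum_def)

lemma open_proj_resolvent: "open (proj_resolvent A)"
proof -
  have "continuous_on UNIV (pencil A)"
    by (intro linear_continuous_on bounded_linear_pencil)
  then have "open (pencil A -` {x. invertible_elt x})"
    by (rule open_vimage[OF open_invertible])
  also have "pencil A -` {x. invertible_elt x} = proj_resolvent A"
    by (auto simp: mem_proj_resolvent)
  finally show ?thesis .
qed

text \<open>A class of functions closed under directional derivatives, so that smoothness of every
  order follows by one induction. It contains \<open>pencil A v\<close> for fixed \<open>v\<close>
  as a constant.\<close>

inductive resolvent_polynomial :: "('n::finite \<Rightarrow> 'b::cstar_algebra) \<Rightarrow> (complex ^ 'n \<Rightarrow> 'b) \<Rightarrow> bool"
  for A where
    const: "resolvent_polynomial A (\<lambda>z. b)"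
  | inverse: "resolvent_polynomial A (\<lambda>z. alg_inverse (pencil A z))"
  | add: "resolvent_polynomial A f \<Longrightarrow> resolvent_polynomial A g \<Longrightarrow> resolvent_polynomial A (\<lambda>z. f z + g z)"
  | mult: "resolvent_polynomial A f \<Longrightarrow> resolvent_polynomial A g \<Longrightarrow> resolvent_polynomial A (\<lambda>z. f z * g z)"

lemma has_derivative_resolvent:
  assumes "z \<in> proj_resolvent A"
  shows "((\<lambda>z. alg_inverse (pencil A z)) has_derivative
    (\<lambda>v. - (alg_inverse (pencil A z) * pencil A v * alg_inverse (pencil A z)))) (at z)"
  using has_derivative_compose[OF bounded_linear_imp_has_derivative[OF bounded_linear_pencil]
      has_derivative_alg_inverse] assms
  by (simp add: mem_proj_resolvent)

lemma resolvent_polynomial_derivative: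
  assumes "resolvent_polynomial A f"
  shows "\<exists>f'. (\<forall>z\<in>proj_resolvent A. (f has_derivative f' z) (at z)) \<and>
    (\<forall>v. resolvent_polynomial A (\<lambda>z. f' z v))"
  using assms
proof induction
  case (const b)
  show ?case
    by (rule exI[of _ "\<lambda>z v. 0"]) (auto intro: resolvent_polynomial.const)
next
  case inverse
  \<comment> \<open>The sign is written as a factor \<open>- 1\<close> so that the derivative of the
    inverse is built from the constructors.\<close>
  have "resolvent_polynomial A
      (\<lambda>z. - 1 * (alg_inverse (pencil A z) * pencil A v * alg_inverse (pencil A z)))" for v
    by (intro resolvent_polynomial.intros)
  then show ?case
    by (intro exI[of _ "\<lambda>z v. - (alg_inverse (pencil A z) * pencil A v * alg_inverse (pencil A z))"])
       (auto intro: has_derivative_resolvent)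
next
  case (add f g)
  from add.IH(1) obtain f' where f': "\<forall>z\<in>proj_resolvent A. (f has_derivative f' z) (at z)"
    "\<forall>v. resolvent_polynomial A (\<lambda>z. f' z v)"
    by (elim exE conjE)
  from add.IH(2) obtain g' where g': "\<forall>z\<in>proj_resolvent A. (g has_derivative g' z) (at z)"
    "\<forall>v. resolvent_polynomial A (\<lambda>z. g' z v)"
    by (elim exE conjE)
  from f' g' show ?case
    by (intro exI[of _ "\<lambda>z v. f' z v + g' z v"])
       (auto intro!: resolvent_polynomial.add has_derivative_add)
next
  case (mult f g)
  from mult.IH(1) obtain f' where f': "\<forall>z\<in>proj_resolvent A. (f has_derivative f' z) (at z)"
    "\<forall>v. resolvent_polynomial A (\<lambda>z. f' z v)"
    by (elim exE conjE)
  from mult.IH(2) obtain g' where g': "\<forall>z\<in>proj_resolvent A. (g has_derivative g' z) (at z)"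
    "\<forall>v. resolvent_polynomial A (\<lambda>z. g' z v)"
    by (elim exE conjE)
  from f' g' mult.hyps show ?case
    by (intro exI[of _ "\<lambda>z v. f z * g' z v + f' z v * g z"])
       (auto intro!: resolvent_polynomial.add resolvent_polynomial.mult has_derivative_mult)
qed

text \<open>Iterated derivatives are total functions whose formulas are known only on
  \<open>U\<close>; openness of \<open>U\<close> allows replacing them there.\<close>

lemma Ck_on_cong:
  assumes "open U" "\<And>x. x \<in> U \<Longrightarrow> f x = g x" "Ck_on k U f"
  shows "Ck_on k U g"
  using assms(2,3)
proof (induction k arbitrary: f g)
  case 0
  then show ?case
    by (simp cong: continuous_on_cong)
next
  case (Suc k)
  have der: "(f has_derivative f') (at x) \<longleftrightarrow> (g has_derivative f') (at x)" if "x \<in> U" for x f'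
    using has_derivative_transform_within_open[OF _ assms(1) that, of f f' UNIV g]
      has_derivative_transform_within_open[OF _ assms(1) that, of g f' UNIV f] Suc.prems(1) by auto
  have eq: "frechet_derivative f (at x) = frechet_derivative g (at x)" if "x \<in> U" for x
    using der[OF that] by (simp add: frechet_derivative_def)
  have "g differentiable (at x)" if "x \<in> U" for x
    using Suc.prems(2) that by (simp add: differentiable_def der)
  moreover have "Ck_on k U (\<lambda>x. frechet_derivative g (at x) v)" for v
    by (rule Suc.IH[of "\<lambda>x. frechet_derivative f (at x) v"]) (use Suc.prems(2) eq in auto)
  ultimately show ?case
    by simp
qed

text \<open>\<open>\<phi>\<close> commutes with differentiation, and the directional derivative of
  \<open>f\<close> is again a resolvent polynomial, so the induction on \<open>k\<close> has
  \<open>f\<close> arbitrary.\<close>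

lemma resolvent_polynomial_Ck:
  assumes "bounded_linear \<phi>" "open U" "U \<subseteq> proj_resolvent A" "resolvent_polynomial A f"
  shows "Ck_on k U (\<lambda>z. \<phi> (f z))"
  using assms(4)
proof (induction k arbitrary: f)
  case (0 f)
  obtain f' where "\<forall>z\<in>proj_resolvent A. (f has_derivative f' z) (at z)"
    using resolvent_polynomial_derivative[OF 0] by (elim exE conjE)
  with assms(3) have "continuous_on U f"
    by (intro has_derivative_continuous_on[of U f f'])
      (auto intro: has_derivative_at_withinI)
  then show ?case
    by (simp add: bounded_linear.continuous_on[OF assms(1)])
next
  case (Suc k f)
  obtain f' where "\<forall>z\<in>proj_resolvent A. (f has_derivative f' z) (at z)"
    and f'_poly: "\<forall>v. resolvent_polynomial A (\<lambda>z. f' z v)"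
    using resolvent_polynomial_derivative[OF Suc.prems] by (elim exE conjE)
  then have f': "(f has_derivative f' z) (at z)" if "z \<in> U" for z
    using assms(3) that by blast
  have der: "((\<lambda>z. \<phi> (f z)) has_derivative (\<lambda>v. \<phi> (f' z v))) (at z)" if "z \<in> U" for z
    by (rule bounded_linear.has_derivative[OF assms(1) f'[OF that]])
  have "Ck_on k U (\<lambda>z. frechet_derivative (\<lambda>z. \<phi> (f z)) (at z) v)" for v
    by (rule Ck_on_cong[OF assms(2) _ Suc.IH[OF f'_poly[rule_format, of v]]])
       (simp add: frechet_derivative_at[OF der, symmetric])
  then show ?case
    using der by (auto simp: differentiable_def)
qed

section \<open>The trace form on the component\<close>

text \<open>With \<open>R\<close> the inverse of the pencil at \<open>z\<close>, the exterior
  derivative is the difference of \<open>\<phi>\<close> at \<open>R A(v) R A(u)\<close> and at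
  \<open>R A(u) R A(v)\<close>; centrality makes the two equal.\<close>

lemma trace_form_closed:
  fixes A :: "'n::finite \<Rightarrow> 'b::cstar_algebra"
  assumes bl: "bounded_linear \<phi>" and central: "\<And>x y. \<phi> (x * y) = \<phi> (y * x)"
    and U: "open U" "U \<subseteq> proj_resolvent A"
  shows "trace_form \<phi> A \<in> closed_forms U"
proof -
  have lin: "linear (trace_form \<phi> A z)" for z
    unfolding trace_form_eq
    using linear_compose[OF linear_compose[OF linear_pencil
        bounded_linear.linear[OF bounded_linear_mult_right]] bounded_linear.linear[OF bl]]
    by (simp add: o_def)
  have "smooth_on U (\<lambda>z. trace_form \<phi> A z v)" for v
    unfolding smooth_on_def trace_form_eq
    by (auto intro!: resolvent_polynomial_Ck[OF bl U] resolvent_polynomial.intros)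
  moreover have "d1 (trace_form \<phi> A) z u v = 0" if "z \<in> U" for z u v
  proof -
    have z: "z \<in> proj_resolvent A"
      using that U by blast
    let ?R = "alg_inverse (pencil A z)"
    have der: "((\<lambda>x. trace_form \<phi> A x w) has_derivative
        (\<lambda>h. \<phi> (- (?R * pencil A h * ?R) * pencil A w))) (at z)" for w
      unfolding trace_form_eq
      by (intro bounded_linear.has_derivative[OF bl]
          bounded_linear.has_derivative[OF bounded_linear_mult_left] has_derivative_resolvent z)
    have "\<phi> (?R * pencil A u * ?R * pencil A v) = \<phi> (?R * pencil A v * ?R * pencil A u)"
      using central[of "?R * pencil A u" "?R * pencil A v"] by (simp add: mult.assoc)
    then show ?thesis
      by (simp add: d1_def frechet_derivative_at[OF der, symmetric]
          linear_neg[OF bounded_linear.linear[OF bl]])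
  qed
  ultimately show ?thesis
    using lin by (simp add: closed_forms_def one_forms_def)
qed

section \<open>Non-exactness, tested on a circle in the component\<close>

lemma Ck_on_const: "Ck_on k U (\<lambda>x. c)"
  by (induction k arbitrary: c) simp_all

text \<open>Reflexivity turns an equality of classes into a relation: a form lies in its own class,
  hence in any class equal to it.\<close>

lemma cohomologous_refl:
  assumes "\<omega> \<in> closed_forms U"
  shows "(\<omega>, \<omega>) \<in> cohomologous U"
proof -
  have "smooth_on U (\<lambda>z. 0)"
    by (simp add: smooth_on_def Ck_on_const)
  moreover have "\<omega> z v - \<omega> z v = d0 (\<lambda>z. 0) z v" for z v
    by (simp add: d0_def)
  ultimately show ?thesis
    using assms by (auto simp: cohomologous_def)
qed

text \<open>The second argument is the velocity of \<open>t \<mapsto> cis t *s z\<close>. By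
  homogeneity the factors \<open>cis t\<close> cancel.\<close>

lemma pencil_circle_speed:
  assumes "invertible_elt (pencil A z)" "positive_functional \<phi>"
  shows "trace_form \<phi> A (cis t *s z) ((\<i> * cis t) *s z) = \<i> * \<phi> 1"
  using assms
  by (simp add: trace_form_eq pencil_cscale alg_inverse_scaleC mult_scaleC_left mult_scaleC_right
      scaleC_scaleC positive_functional_simps(2) field_simps)

lemma circle_in_resolvent:
  assumes "z \<in> proj_resolvent A" "norm w = 1"
  shows "w *s z \<in> proj_resolvent A"
  using assms by (auto simp: mem_proj_resolvent pencil_cscale intro!: invertible_scaleC)

lemma continuous_on_cscale [continuous_intros]:
  assumes "continuous_on S f"
  shows "continuous_on S (\<lambda>w. f w *s (z :: complex ^ 'n::finite))"
  unfolding vector_scalar_mult_def using assms by (intro continuous_intros)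

text \<open>The circle through \<open>z\<close> is connected and stays in the resolvent set, so
  maximality of the component applies.\<close>

lemma circle_in_component:
  assumes "U \<in> components (proj_resolvent A)" "z \<in> U" "norm w = 1"
  shows "w *s z \<in> U"
proof -
  have "connected ((\<lambda>w. w *s z) ` sphere (0::complex) 1)"
    by (intro connected_continuous_image continuous_intros connected_sphere) simp
  moreover have "z \<in> (\<lambda>w. w *s z) ` sphere (0::complex) 1"
    by (rule image_eqI[of _ _ 1]) auto
  moreover have "(\<lambda>w. w *s z) ` sphere (0::complex) 1 \<subseteq> proj_resolvent A"
    using in_components_subset[OF assms(1)] assms(2) by (auto intro: circle_in_resolvent)
  ultimately have "(\<lambda>w. w *s z) ` sphere (0::complex) 1 \<subseteq> U"
    using components_maximal[OF assms(1)] assms(2) by blast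
  then show ?thesis
    using assms(3) by (simp add: image_subset_iff)
qed

text \<open>On the circle such an \<open>f\<close> would change at a constant nonzero rate although
  the circle closes up. The minus sign comes from comparing the zero form with the trace form, in
  this order.\<close>

lemma trace_form_not_exact:
  assumes \<phi>: "positive_functional \<phi>" "\<phi> 1 \<noteq> 0"
    and U: "open U" "U \<subseteq> proj_resolvent A" and circle: "\<And>w. norm w = 1 \<Longrightarrow> w *s z \<in> U"
    and f: "\<And>x. x \<in> U \<Longrightarrow> f differentiable (at x)"
  shows "\<exists>x\<in>U. \<exists>v. d0 f x v \<noteq> - trace_form \<phi> A x v"
proof (rule ccontr)
  assume "\<not> ?thesis"
  then have d0: "d0 f x v = - trace_form \<phi> A x v" if "x \<in> U" for x v
    using that by blast
  have "1 *s z \<in> U"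
    by (rule circle) simp
  then have z: "invertible_elt (pencil A z)"
    using U by (auto simp flip: mem_proj_resolvent)
  define g where "g t = f (cis t *s z)" for t
  have "(g has_vector_derivative - (\<i> * \<phi> 1)) (at t)" for t
  proof -
    have inU: "cis t *s z \<in> U"
      by (rule circle) simp
    have "((\<lambda>t. cis t *s z) has_vector_derivative (\<i> * cis t) *s z) (at t)"
    proof (rule bounded_linear.has_vector_derivative[of "\<lambda>w. w *s z"])
      show "bounded_linear (\<lambda>w. w *s z)"
        by (rule linear_conv_bounded_linear[THEN iffD1], rule linearI)
           (auto simp: vec_eq_iff algebra_simps)
      show "(cis has_vector_derivative \<i> * cis t) (at t)"
        unfolding cis_conv_exp
        by (rule has_vector_derivative_real_field[where f="\<lambda>z. exp (\<i> * z)"])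
           (auto intro!: derivative_eq_intros)
    qed
    then have "((\<lambda>t. cis t *s z) has_derivative (\<lambda>h. h *\<^sub>R ((\<i> * cis t) *s z))) (at t)"
      by (simp add: has_vector_derivative_def)
    from has_derivative_compose[OF this] f[OF inU]
    have "(g has_derivative (\<lambda>h. frechet_derivative f (at (cis t *s z)) (h *\<^sub>R ((\<i> * cis t) *s z)))) (at t)"
      unfolding g_def by (simp add: frechet_derivative_works)
    moreover have "frechet_derivative f (at (cis t *s z)) (h *\<^sub>R ((\<i> * cis t) *s z)) =
        h *\<^sub>R - (\<i> * \<phi> 1)" for h
      using d0[OF inU, of "(\<i> * cis t) *s z"] pencil_circle_speed[OF z \<phi>(1), of t]
        linear_cmul[OF linear_frechet_derivative[OF f[OF inU]]]
      by (simp add: d0_def)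
    ultimately show ?thesis
      by (simp add: has_vector_derivative_def)
  qed
  \<comment> \<open>Adding the opposite linear drift gives a constant function, while
    \<open>g\<close> itself takes equal values at 0 and \<open>2 * pi\<close>.\<close>
  then have "((\<lambda>t. g t + of_real t * (\<i> * \<phi> 1)) has_derivative (\<lambda>h. 0)) (at t)" for t
    by (auto intro!: derivative_eq_intros simp: has_vector_derivative_def scaleR_conv_of_real)
  then have "\<exists>c. \<forall>t\<in>UNIV. g t + of_real t * (\<i> * \<phi> 1) = c"
    by (intro has_derivative_zero_constant) auto
  then obtain k where "\<And>t. g t + of_real t * (\<i> * \<phi> 1) = k"
    by auto
  from this[of "2 * pi"] this[of 0]
  have "g (2 * pi) + of_real (2 * pi) * (\<i> * \<phi> 1) = g 0 + of_real 0 * (\<i> * \<phi> 1)"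
    by (simp only:)
  then show False
    using \<phi>(2) by (simp add: g_def)
qed

section \<open>Loops around the projective spectrum\<close>

text \<open>The integral of the form \<open>\<phi>(x^-1 dx)\<close> over the segment from
  \<open>a\<close> to \<open>b\<close>, formally the change of \<open>\<phi>(log x)\<close>. It
  lives in the algebra because the pencil, being linear, maps segments to segments.\<close>

definition log_increment :: "('b::cstar_algebra \<Rightarrow> complex) \<Rightarrow> 'b \<Rightarrow> 'b \<Rightarrow> complex"
  where "log_increment \<phi> a b = integral {0..1} (\<lambda>t. \<phi> (alg_inverse (a + t *\<^sub>R (b - a)) * (b - a)))"

text \<open>Stokes on the triangle \<open>a\<close>, \<open>b\<close>, \<open>d\<close>. The
  endpoint of a segment from \<open>a\<close> moves from \<open>b\<close> to \<open>d\<close>, and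
  the increment is differentiated under the integral sign.\<close>

lemma log_increment_cocycle:
  fixes K :: "'b::cstar_algebra set"
  assumes bl: "bounded_linear \<phi>" and central: "\<And>x y. \<phi> (x * y) = \<phi> (y * x)"
    and K: "convex K" "K \<subseteq> {x. invertible_elt x}" and abd: "a \<in> K" "b \<in> K" "d \<in> K"
  shows "log_increment \<phi> a b + log_increment \<phi> b d = log_increment \<phi> a d"
proof -
  define e where "e = d - b"
  \<comment> \<open>\<open>m s\<close> points from \<open>a\<close> to the moving endpoint,
    \<open>x s t\<close> runs along that segment, and \<open>f' s t\<close> is the derivative of the
    integrand in \<open>s\<close>.\<close>
  define m where "m s = b + s *\<^sub>R e - a" for s
  define x where "x s t = a + t *\<^sub>R m s" for s t
  define f where "f s t = \<phi> (alg_inverse (x s t) * m s)" for s t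
  define f' where "f' s t = \<phi> (alg_inverse (x s t) * e
      + - (alg_inverse (x s t) * (t *\<^sub>R e) * alg_inverse (x s t)) * m s)" for s t
  have segment: "u + t *\<^sub>R (v - u) \<in> K" if "u \<in> K" "v \<in> K" "t \<in> {0..1}" for u v t
    using convexD_alt[OF K(1) that(1,2), of t] that(3) by (simp add: algebra_simps)
  have y: "b + s *\<^sub>R e \<in> K" if "s \<in> {0..1}" for s
    unfolding e_def using abd that by (intro segment)
  have inv: "invertible_elt (x s t)" if "s \<in> {0..1}" "t \<in> {0..1}" for s t
    using segment[OF abd(1) y[OF that(1)] that(2)] K(2) by (auto simp: x_def m_def)
  note [continuous_intros] = bounded_linear.continuous_on[OF bl]
  have leibniz: "((\<lambda>s. integral (cbox 0 1) (f s)) has_vector_derivative integral (cbox 0 1) (f' s))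
      (at s within {0..1})" if s: "s \<in> {0..1}" for s
  proof (rule leibniz_rule_vector_derivative)
    fix s t :: real
    assume st: "s \<in> {0..1}" "t \<in> cbox 0 1"
    have m': "(m has_vector_derivative e) (at s within {0..1})"
      unfolding m_def by (auto intro!: derivative_eq_intros)
    have "((\<lambda>s. x s t) has_vector_derivative t *\<^sub>R e) (at s within {0..1})"
      unfolding x_def m_def by (auto intro!: derivative_eq_intros)
    from has_vector_derivative_alg_inverse[OF this] inv st
    have "((\<lambda>s. alg_inverse (x s t)) has_vector_derivative
        - (alg_inverse (x s t) * (t *\<^sub>R e) * alg_inverse (x s t))) (at s within {0..1})"
      by simp
    from has_vector_derivative_mult[OF this m']
    show "((\<lambda>s. f s t) has_vector_derivative f' s t) (at s within {0..1})"
      unfolding f_def f'_def by (intro bounded_linear.has_vector_derivative[OF bl])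
  next
    fix s :: real
    assume "s \<in> {0..1}"
    then show "f s integrable_on cbox 0 1"
      unfolding f_def using inv
      by (intro integrable_continuous) (auto intro!: continuous_intros simp: x_def)
  next
    show "continuous_on ({0..1} \<times> cbox 0 1) (\<lambda>(s, t). f' s t)"
      unfolding f'_def split_beta using inv
      by (auto intro!: continuous_intros simp: x_def m_def)
  qed (use s in auto)
  have f'_integral: "integral (cbox 0 1) (f' s) = \<phi> (alg_inverse (b + s *\<^sub>R e) * e)" if s: "s \<in> {0..1}" for s
  proof -
    \<comment> \<open>Centrality exchanges \<open>m s\<close> and \<open>e\<close>, which makes the
      \<open>s\<close>-derivative of the integrand a total \<open>t\<close>-derivative. The factor
      \<open>t\<close> kills the boundary term at \<open>a\<close>.\<close>
    have "((\<lambda>t. t *\<^sub>R \<phi> (alg_inverse (x s t) * e)) has_vector_derivative f' s t) (at t within {0..1})"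
      if t: "t \<in> {0..1}" for t
    proof -
      let ?R = "alg_inverse (x s t)"
      have "((\<lambda>t. x s t) has_vector_derivative m s) (at t within {0..1})"
        unfolding x_def by (auto intro!: derivative_eq_intros)
      from has_vector_derivative_alg_inverse[OF this inv[OF s t]]
      have "((\<lambda>t. alg_inverse (x s t) * e) has_vector_derivative - (?R * m s * ?R) * e)
          (at t within {0..1})"
        by (rule bounded_linear.has_vector_derivative[OF bounded_linear_mult_left])
      then have "((\<lambda>t. \<phi> (alg_inverse (x s t) * e)) has_vector_derivative \<phi> (- (?R * m s * ?R) * e))
          (at t within {0..1})"
        by (rule bounded_linear.has_vector_derivative[OF bl])
      then have "((\<lambda>t. t *\<^sub>R \<phi> (alg_inverse (x s t) * e)) has_vector_derivative
          t *\<^sub>R \<phi> (- (?R * m s * ?R) * e) + \<phi> (?R * e)) (at t within {0..1})"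
        by (auto intro!: derivative_eq_intros)
      moreover have "\<phi> (?R * m s * ?R * e) = \<phi> (?R * e * ?R * m s)"
        using central[of "?R * m s" "?R * e"] by (simp add: mult.assoc)
      ultimately show ?thesis
        using linear_neg[OF bounded_linear.linear[OF bl]]
          linear_cmul[OF bounded_linear.linear[OF bl]] linear_add[OF bounded_linear.linear[OF bl]]
          linear_diff[OF bounded_linear.linear[OF bl]]
        by (simp add: f'_def)
    qed
    then have "(f' s has_integral 1 *\<^sub>R \<phi> (alg_inverse (x s 1) * e) - 0 *\<^sub>R \<phi> (alg_inverse (x s 0) * e)) {0..1}"
      by (intro fundamental_theorem_of_calculus) auto
    then show ?thesis
      by (simp add: integral_unique x_def m_def)
  qed
  have "((\<lambda>s. \<phi> (alg_inverse (b + s *\<^sub>R e) * e)) has_integral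
      integral (cbox 0 1) (f 1) - integral (cbox 0 1) (f 0)) {0..1}"
    using leibniz by (intro fundamental_theorem_of_calculus) (auto simp flip: f'_integral)
  then have "log_increment \<phi> b d = integral {0..1} (f 1) - integral {0..1} (f 0)"
    by (simp add: log_increment_def e_def integral_unique)
  then show ?thesis
    by (simp add: log_increment_def f_def[abs_def] x_def m_def e_def)
qed

text \<open>Points of the segment are multiples \<open>1 + t w\<close> of \<open>a\<close>, so the
  integrand is \<open>\<phi> 1\<close> times the derivative of \<open>Ln (1 + t w)\<close>. The
  bound on \<open>\<theta>\<close> keeps the segment in the right half-plane, off the branch
  cut.\<close>

lemma log_increment_rotation:
  fixes a :: "'b::cstar_algebra"
  assumes \<phi>: "positive_functional \<phi>" and a: "invertible_elt a" and \<theta>: "\<bar>\<theta>\<bar> < pi / 2"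
  shows "log_increment \<phi> a (cis \<theta> *\<^sub>C a) = \<i> * \<theta> * \<phi> 1"
proof -
  define w where "w = cis \<theta> - 1"
  have Re: "Re (1 + of_real t * w) > 0" if "t \<in> {0..1}" for t
  proof -
    have "cos \<theta> > 0"
      using \<theta> by (intro cos_gt_zero_pi) auto
    then have "0 < (1 - t) * 1 + t * cos \<theta>"
      using that by (cases "t = 0") (auto intro!: add_nonneg_pos)
    then show ?thesis
      by (simp add: w_def algebra_simps)
  qed
  have step: "cis \<theta> *\<^sub>C a - a = w *\<^sub>C a"
    using scaleC_add_left[of w 1 a] by (simp add: w_def)
  have point: "a + t *\<^sub>R (cis \<theta> *\<^sub>C a - a) = (1 + of_real t * w) *\<^sub>C a" for t
    unfolding step by (simp add: scaleC_add_left scaleC_of_real flip: scaleC_scaleC)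
  have integrand: "\<phi> (alg_inverse (a + t *\<^sub>R (cis \<theta> *\<^sub>C a - a)) * (cis \<theta> *\<^sub>C a - a))
      = w / (1 + of_real t * w) * \<phi> 1" if "t \<in> {0..1}" for t
  proof -
    have "1 + of_real t * w \<noteq> 0"
      using Re[OF that] by (metis less_irrefl zero_complex.sel(1))
    then show ?thesis
      unfolding point unfolding step using a
      by (simp add: alg_inverse_scaleC mult_scaleC_left mult_scaleC_right scaleC_scaleC
          positive_functional_simps(2)[OF \<phi>] field_simps)
  qed
  have "((\<lambda>t. Ln (1 + of_real t * w) * \<phi> 1) has_vector_derivative w / (1 + of_real t * w) * \<phi> 1)
      (at t within {0..1})" if "t \<in> {0..1}" for t
  proof (rule has_vector_derivative_at_within,
      rule has_vector_derivative_real_field[where f="\<lambda>z. Ln (1 + z * w) * \<phi> 1"])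
    have "1 + of_real t * w \<notin> \<real>\<^sub>\<le>\<^sub>0"
      using Re[OF that] by (auto simp: complex_nonpos_Reals_iff)
    then show "((\<lambda>z. Ln (1 + z * w) * \<phi> 1) has_field_derivative w / (1 + of_real t * w) * \<phi> 1)
        (at (of_real t))"
      by (auto intro!: derivative_eq_intros simp: field_simps)
  qed
  then have "((\<lambda>t. w / (1 + of_real t * w) * \<phi> 1) has_integral
      Ln (1 + of_real 1 * w) * \<phi> 1 - Ln (1 + of_real 0 * w) * \<phi> 1) {0..1}"
    by (intro fundamental_theorem_of_calculus) auto
  moreover have "Ln (cis \<theta>) = \<i> * \<theta>"
    unfolding cis_conv_exp using \<theta> by (intro Ln_exp) auto
  ultimately have "((\<lambda>t. w / (1 + of_real t * w) * \<phi> 1) has_integral \<i> * \<theta> * \<phi> 1) {0..1}"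
    by (simp add: w_def)
  then have "((\<lambda>t. \<phi> (alg_inverse (a + t *\<^sub>R (cis \<theta> *\<^sub>C a - a)) * (cis \<theta> *\<^sub>C a - a)))
      has_integral \<i> * \<theta> * \<phi> 1) {0..1}"
    using integrand by (subst has_integral_cong) auto
  then show ?thesis
    by (simp add: log_increment_def integral_unique)
qed

text \<open>
  Comparing the paths from a base point to \<open>p\<close> and to \<open>q\<close> rung by rung, the cocycle identity
  makes the difference of the two sums telescope.
\<close>

lemma local_cocycle_is_coboundary:
  fixes c :: "'a::real_normed_vector \<Rightarrow> 'a \<Rightarrow> 'c::ab_group_add"
  assumes D: "convex D" "bounded D" and \<delta>: "\<delta> > 0"
    and cocycle: "\<And>p q r. \<lbrakk>p \<in> D; q \<in> D; r \<in> D; dist p q < \<delta>; dist q r < \<delta>; dist p r < \<delta>\<rbrakk>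
      \<Longrightarrow> c p q + c q r = c p r"
  obtains g where "\<And>p q. \<lbrakk>p \<in> D; q \<in> D; dist p q < \<delta> / 2\<rbrakk> \<Longrightarrow> c p q = g q - g p"
proof (cases "D = {}")
  case True
  then show ?thesis
    using that[of "\<lambda>_. 0"] by auto
next
  case False
  then obtain o' where o': "o' \<in> D"
    by blast
  obtain B where B: "\<And>p. p \<in> D \<Longrightarrow> dist o' p \<le> B"
    using D(2) bounded_any_center[of D o'] by auto
  \<comment> \<open>This many subdivisions make each step along a path from the base point shorter
    than \<open>\<delta> / 2\<close>.\<close>
  obtain N :: nat where N: "2 * B / \<delta> < N" "N > 0"
    using reals_Archimedean2[of "max 1 (2 * B / \<delta>)"] by auto
  define pt where "pt p i = o' + (real i / N) *\<^sub>R (p - o')" for p i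
  define g where "g p = (\<Sum>i<N. c (pt p i) (pt p (Suc i)))" for p
  have pt: "pt p i \<in> D" if "p \<in> D" "i \<le> N" for p i
  proof -
    have "o' + u *\<^sub>R (p - o') = (1 - u) *\<^sub>R o' + u *\<^sub>R p" for u
      by (simp add: algebra_simps)
    then show ?thesis
      unfolding pt_def using convexD_alt[OF D(1) o' that(1), of "real i / N"] that(2) N(2) by simp
  qed
  have along: "dist (pt p i) (pt p (Suc i)) < \<delta> / 2" if "p \<in> D" for p i
  proof -
    have "pt p (Suc i) - pt p i = (1 / N) *\<^sub>R (p - o')"
      unfolding pt_def add_diff_cancel_left scaleR_left_diff_distrib[symmetric]
      by (simp flip: diff_divide_distrib)
    then have "dist (pt p i) (pt p (Suc i)) = dist o' p / N"
      by (simp add: dist_norm norm_minus_commute[of "pt p i"] norm_minus_commute[of o'])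
    also have "\<dots> \<le> B / N"
      using B[OF that] by (simp add: divide_right_mono)
    also have "\<dots> < \<delta> / 2"
      using N \<delta> by (simp add: field_simps)
    finally show ?thesis .
  qed
  have across: "dist (pt p i) (pt q i) \<le> dist p q" if "i \<le> N" for p q i
  proof -
    have "pt p i - pt q i = (real i / N) *\<^sub>R (p - q)"
      unfolding pt_def add_diff_cancel_left scaleR_right_diff_distrib[symmetric] by simp
    then have "dist (pt p i) (pt q i) = real i / N * dist p q"
      by (simp add: dist_norm)
    also have "\<dots> \<le> 1 * dist p q"
      using that by (intro mult_right_mono) (auto simp: divide_le_eq)
    finally show ?thesis
      by simp
  qed
  have "c p q = g q - g p" if p: "p \<in> D" and q: "q \<in> D" and pq: "dist p q < \<delta> / 2" for p q
  proof -
    \<comment> \<open>Each quadrilateral is cut along the diagonal from \<open>pt p i\<close> to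
      \<open>pt q (Suc i)\<close>. Its sides are below \<open>\<delta> / 2\<close>, so the diagonal
      is below \<open>\<delta>\<close>; this is why the conclusion halves
      \<open>\<delta>\<close>.\<close>
    have rung: "c (pt q i) (pt q (Suc i)) - c (pt p i) (pt p (Suc i)) =
        c (pt p (Suc i)) (pt q (Suc i)) - c (pt p i) (pt q i)" if "i < N" for i
    proof -
      have close: "dist (pt p i) (pt p (Suc i)) < \<delta> / 2" "dist (pt q i) (pt q (Suc i)) < \<delta> / 2"
        "dist (pt p i) (pt q i) < \<delta> / 2" "dist (pt p (Suc i)) (pt q (Suc i)) < \<delta> / 2"
        using along p q across[of i p q] across[of "Suc i" p q] pq that by (auto intro: le_less_trans)
      then have diag: "dist (pt p i) (pt q (Suc i)) < \<delta>"
        using dist_triangle[of "pt p i" "pt q (Suc i)" "pt q i"] by linarith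
      have "c (pt p i) (pt p (Suc i)) + c (pt p (Suc i)) (pt q (Suc i)) = c (pt p i) (pt q (Suc i))"
        using close diag \<delta> that by (intro cocycle pt p q) auto
      moreover have "c (pt p i) (pt q i) + c (pt q i) (pt q (Suc i)) = c (pt p i) (pt q (Suc i))"
        using close diag \<delta> that by (intro cocycle pt p q) auto
      ultimately show ?thesis
        by (simp add: algebra_simps)
    qed
    have "g q - g p = (\<Sum>i<N. c (pt p (Suc i)) (pt q (Suc i)) - c (pt p i) (pt q i))"
      unfolding g_def sum_subtractf[symmetric] by (intro sum.cong refl rung) simp
    also have "\<dots> = c (pt p N) (pt q N) - c (pt p 0) (pt q 0)"
      by (rule sum_lessThan_telescope)
    \<comment> \<open>Both paths start at \<open>o'\<close>, and the cocycle identity at three equal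
      points gives \<open>c o' o' = 0\<close>.\<close>
    also have "\<dots> = c p q"
      using N(2) cocycle[OF o' o' o'] \<delta> by (simp add: pt_def)
    finally show ?thesis
      by simp
  qed
  with that show ?thesis
    by blast
qed

lemma circle_obstructs_simple_connectedness:
  fixes \<phi> :: "'b::cstar_algebra \<Rightarrow> complex" and A :: "'n::finite \<Rightarrow> 'b"
  assumes \<phi>: "positive_functional \<phi>" "\<phi> 1 \<noteq> 0" and central: "\<And>x y. \<phi> (x * y) = \<phi> (y * x)"
    and U: "open U" "U \<subseteq> proj_resolvent A" and circle: "\<And>w. norm w = 1 \<Longrightarrow> w *s z \<in> U"
  shows "\<not> simply_connected U"
proof
  assume "simply_connected U"
  note bl = positive_functional_bounded_linear[OF \<phi>(1)]
  have "continuous_on (sphere (0::complex) 1) (\<lambda>w. w *s z)"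
    by (intro continuous_intros)
  moreover have "(\<lambda>w. w *s z) ` sphere 0 1 \<subseteq> U"
    using circle by auto
  ultimately have "\<exists>a. homotopic_with_canon (\<lambda>h. True) (sphere (0::complex) 1) U (\<lambda>w. w *s z) (\<lambda>x. a)"
    using \<open>simply_connected U\<close> simply_connected_eq_contractible_circlemap[of U] by blast
  \<comment> \<open>A nullhomotopy of the circle is the same as a continuous extension to the closed
    disc.\<close>
  then obtain F where F: "continuous_on (cball (0::complex) 1) F" "F ` cball 0 1 \<subseteq> U"
    and F_circle: "\<And>w. norm w = 1 \<Longrightarrow> F w = w *s z"
    using nullhomotopic_from_sphere_extension[of "0::complex" 1 U "\<lambda>w. w *s z"] by auto
  have "compact (F ` cball 0 1)"
    using F(1) by (intro compact_continuous_image) auto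
  \<comment> \<open>A uniform tube around the disc: the images of points closer than
    \<open>\<delta>\<close> lie in one ball inside \<open>U\<close>, which supplies the convex set
    for the cocycle lemma.\<close>
  then obtain \<epsilon> where \<epsilon>: "\<epsilon> > 0" "(\<Union>x\<in>F ` cball 0 1. ball x \<epsilon>) \<subseteq> U"
    by (rule compact_subset_open_imp_ball_epsilon_subset[OF _ U(1) F(2)])
  have "uniformly_continuous_on (cball 0 1) F"
    using F(1) by (intro compact_uniformly_continuous) auto
  then obtain \<delta> where \<delta>: "\<delta> > 0"
    "\<forall>q\<in>cball 0 1. \<forall>p\<in>cball 0 1. dist p q < \<delta> \<longrightarrow> dist (F p) (F q) < \<epsilon>"
    using \<epsilon>(1) unfolding uniformly_continuous_on_def by blast
  define c where "c p q = log_increment \<phi> (pencil A (F p)) (pencil A (F q))" for p q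
  have cocycle: "c p q + c q r = c p r" if pqr: "p \<in> cball 0 1" "q \<in> cball 0 1" "r \<in> cball 0 1"
    and close: "dist p q < \<delta>" "dist q r < \<delta>" "dist p r < \<delta>" for p q r
    unfolding c_def
  proof (rule log_increment_cocycle[OF bl central])
    let ?K = "pencil A ` ball (F p) \<epsilon>"
    show "convex ?K"
      by (intro convex_linear_image linear_pencil convex_ball)
    have "ball (F p) \<epsilon> \<subseteq> proj_resolvent A"
      using \<epsilon>(2) pqr(1) U(2) by blast
    then show "?K \<subseteq> {x. invertible_elt x}"
      by (auto simp flip: mem_proj_resolvent)
    show "pencil A (F p) \<in> ?K" "pencil A (F q) \<in> ?K" "pencil A (F r) \<in> ?K"
      using \<epsilon>(1) \<delta>(2) pqr close by (auto intro!: imageI)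
  qed
  obtain g where g: "\<And>p q. \<lbrakk>p \<in> cball 0 1; q \<in> cball 0 1; dist p q < \<delta> / 2\<rbrakk> \<Longrightarrow> c p q = g q - g p"
    by (rule local_cocycle_is_coboundary[of "cball 0 1" \<delta> c];
        (rule convex_cball bounded_cball \<delta>(1) | erule (5) cocycle | rule that, simp))
  have "(\<lambda>M. cis (2 * pi / real M)) \<longlonglongrightarrow> cis 0"
    unfolding cis_conv_exp by (auto intro!: tendsto_eq_intros lim_const_over_n)
  then have "eventually (\<lambda>M. dist (cis (2 * pi / real M)) (cis 0) < \<delta> / 2) sequentially"
    using \<delta>(1) by (intro tendstoD) auto
  \<comment> \<open>More than four vertices keep the angle below \<open>pi / 2\<close> for the
    rotation lemma; the other condition makes the edges short enough for \<open>g\<close>.\<close>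
  then have "eventually (\<lambda>M. M > 4 \<and> dist (cis (2 * pi / real M)) (cis 0) < \<delta> / 2) sequentially"
    using eventually_gt_at_top by (rule eventually_conj[rotated])
  then obtain M :: nat where M: "M > 4" "dist (cis (2 * pi / real M)) (cis 0) < \<delta> / 2"
    using eventually_happens'[OF sequentially_bot] by blast
  define \<theta> where "\<theta> = 2 * pi / real M"
  have "\<bar>\<theta>\<bar> < pi / 2"
    using M(1) by (simp add: \<theta>_def field_simps)
  \<comment> \<open>The increment over one edge is computed twice: by rotation of the pencil and by
    the primitive \<open>g\<close>.\<close>
  have step: "\<i> * \<theta> * \<phi> 1 = g (cis (real (Suc k) * \<theta>)) - g (cis (real k * \<theta>))" for k
  proof -
    have rot: "cis (real (Suc k) * \<theta>) = cis \<theta> * cis (real k * \<theta>)"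
      by (simp add: cis_mult distrib_right)
    have "dist (cis (real k * \<theta>)) (cis (real (Suc k) * \<theta>)) = norm (cis (real k * \<theta>) * (1 - cis \<theta>))"
      unfolding rot dist_norm by (simp add: algebra_simps)
    also have "\<dots> < \<delta> / 2"
      using M(2) by (simp add: norm_mult dist_norm norm_minus_commute \<theta>_def)
    finally have "c (cis (real k * \<theta>)) (cis (real (Suc k) * \<theta>)) =
        g (cis (real (Suc k) * \<theta>)) - g (cis (real k * \<theta>))"
      by (intro g) auto
    moreover have "invertible_elt (pencil A (cis (real k * \<theta>) *s z))"
      using circle[of "cis (real k * \<theta>)"] U(2) by (auto simp flip: mem_proj_resolvent)
    from log_increment_rotation[OF \<phi>(1) this \<open>\<bar>\<theta>\<bar> < pi / 2\<close>]
    have "c (cis (real k * \<theta>)) (cis (real (Suc k) * \<theta>)) = \<i> * \<theta> * \<phi> 1"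
      unfolding rot c_def by (simp add: F_circle norm_mult pencil_cscale scaleC_scaleC)
    ultimately show ?thesis
      by simp
  qed
  have "of_nat M * (\<i> * \<theta> * \<phi> 1) = (\<Sum>k<M. g (cis (real (Suc k) * \<theta>)) - g (cis (real k * \<theta>)))"
    unfolding step[symmetric] by simp
  also have "\<dots> = g (cis (real M * \<theta>)) - g (cis (real 0 * \<theta>))"
    by (rule sum_lessThan_telescope)
  \<comment> \<open>The polygon closes since \<open>M\<close> times \<open>\<theta>\<close> is
    \<open>2 * pi\<close>, while the left side is \<open>2 * pi * \<i> * \<phi> 1\<close>.\<close>
  also have "\<dots> = 0"
    using M(1) by (simp add: \<theta>_def)
  finally show False
    using M(1) \<phi>(2) by (simp add: \<theta>_def)
qed

theorem theorem3p3:
  fixes \<phi> :: "'b::cstar_algebra \<Rightarrow> complex"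
    and A :: "'n::finite \<Rightarrow> 'b"
    and U :: "(complex ^ 'n) set"
  assumes trace: "is_trace \<phi>"
    and nonzero: "\<exists>x. \<phi> x \<noteq> 0"
    and dim: "CARD('n) \<ge> 2"
    and U: "U \<in> components (proj_resolvent A)"
  shows "trace_form \<phi> A \<in> closed_forms U
    \<and> deRham_class U (trace_form \<phi> A) \<in> deRham_H1 U
    \<and> deRham_class U (trace_form \<phi> A) \<noteq> deRham_zero U
    \<and> \<not> simply_connected U"
proof -
  have pos: "positive_functional \<phi>" and central: "\<And>x y. \<phi> (x * y) = \<phi> (y * x)"
    using trace by (auto simp: is_trace_def)
  have one: "\<phi> 1 \<noteq> 0"
    using nonzero positive_functional_Cauchy_Schwarz(2)[OF pos] by auto
  have U_open: "open U" "U \<subseteq> proj_resolvent A"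
    using open_components[OF open_proj_resolvent U] in_components_subset[OF U] by auto
  obtain z where "z \<in> U"
    using in_components_nonempty[OF U] by blast
  then have circle: "w *s z \<in> U" if "norm w = 1" for w
    using circle_in_component[OF U] that by blast
  have closed: "trace_form \<phi> A \<in> closed_forms U"
    by (rule trace_form_closed[OF positive_functional_bounded_linear[OF pos] central U_open])
  have "deRham_class U (trace_form \<phi> A) \<noteq> deRham_zero U"
  proof
    assume "deRham_class U (trace_form \<phi> A) = deRham_zero U"
    then have "(\<lambda>z v. 0, trace_form \<phi> A) \<in> cohomologous U"
      using cohomologous_refl[OF closed] by (auto simp: deRham_class_def deRham_zero_def)
    then obtain f where f: "smooth_on U f"
      "\<And>x v. x \<in> U \<Longrightarrow> d0 f x v = - trace_form \<phi> A x v"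
      by (auto simp: cohomologous_def)
    have "Ck_on (Suc 0) U f"
      using f(1) by (simp only: smooth_on_def)
    then have "f differentiable (at x)" if "x \<in> U" for x
      using that by simp
    then show False
      using trace_form_not_exact[OF pos one U_open circle, of f] f(2) by blast
  qed
  moreover have "deRham_class U (trace_form \<phi> A) \<in> deRham_H1 U"
    unfolding deRham_class_def deRham_H1_def using closed by (rule quotientI)
  moreover have "\<not> simply_connected U"
    by (rule circle_obstructs_simple_connectedness[OF pos one central U_open circle])
  ultimately show ?thesis
    using closed by blast
qed

end
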